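(* Let $t,m,s,v$ be positive integers with $t\ge 2$, $m\geq 2$ and $s\leq t\leq ms$, and let $k=\min\{2s,t\}$. Then $$OCAN(t,m+1,s,v)\ \leq\ OCAN(t,m,s,v)+\sum_{j=2}^{k} OCAN(t-j,m-1,s,v)\cdot \left(v^{j}-v^{\lceil j/2\rceil}\right).$$
   Context: NRT poset: for positive integers $m,s$, the NRT poset $[m\cdot s]$ is the set $\{1,\ldots,ms\}$ partitioned into $m$ blocks $B_i=\{is+1,\ldots,(i+1)s\}$, $i=0,\ldots,m-1$, where each block is a chain $is+1\preceq is+2\preceq\cdots\preceq (i+1)s$ and elements of different blocks are incomparable. An ideal is a subset $I$ such that $b\in I$ and $a\preceq b$ imply $a\in I$; an anti-ideal is the complement of an ideal (so an anti-ideal consists of a possibly empty set of the largest elements of each block). Covering: given an $N\times n$ array over an alphabet $V$ of size $v$, a set of $t$ columns is covered if every $t$-tuple over $V$ occurs at least once as a row of the $N\times t$ subarray formed by those columns. Ordered covering array: an $OCA(N;t,m,s,v)$ is an $N\times ms$ array with entries from an alphabet of size $v$, with columns labeled by $[m\cdot s]$, such that for every anti-ideal $J$ of $[m\cdot s]$ with $|J|=t$ the set of columns labeled by $J$ is covered. $OCAN(t,m,s,v)$ is the smallest positive integer $N$ such that an $OCA(N;t,m,s,v)$ exists. These definitions are used for every strength $t\ge 0$, with $s$ allowed to exceed the strength. In particular $OCAN(0,m,s,v)=1$, and if the strength exceeds $ms$ then there are no anti-ideals of that size, the condition is vacuous, and the number equals $1$. *)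

theory Defs
  imports Complex_Main "HOL-Library.FuncSet"
begin

definition nrt_points :: "nat \<Rightarrow> nat \<Rightarrow> nat set" where
  "nrt_points m s = {1..m * s}"

definition nrt_block :: "nat \<Rightarrow> nat \<Rightarrow> nat set" where
  "nrt_block s i = {i * s + 1..(i + 1) * s}"

definition nrt_le :: "nat \<Rightarrow> nat \<Rightarrow> nat \<Rightarrow> nat \<Rightarrow> bool" where
  "nrt_le m s a b \<longleftrightarrow> (\<exists>i<m. a \<in> nrt_block s i \<and> b \<in> nrt_block s i \<and> a \<le> b)"

definition nrt_ideal :: "nat \<Rightarrow> nat \<Rightarrow> nat set \<Rightarrow> bool" where
  "nrt_ideal m s I \<longleftrightarrow>
     I \<subseteq> nrt_points m s \<and> (\<forall>b\<in>I. \<forall>a\<in>nrt_points m s. nrt_le m s a b \<longrightarrow> a \<in> I)"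

definition nrt_anti_ideal :: "nat \<Rightarrow> nat \<Rightarrow> nat set \<Rightarrow> bool" where
  "nrt_anti_ideal m s J \<longleftrightarrow> (\<exists>I. nrt_ideal m s I \<and> J = nrt_points m s - I)"

text \<open>An array with \<open>N\<close> rows is a function \<open>A\<close>, read as \<open>A r c\<close> for rows \<open>r < N\<close> and
  column labels \<open>c\<close>. A tuple over \<open>V\<close> whose positions are the columns in \<open>J\<close> is an
  element of \<open>J \<rightarrow>\<^sub>E V\<close>.\<close>

definition covered :: "nat \<Rightarrow> (nat \<Rightarrow> nat \<Rightarrow> 'a) \<Rightarrow> 'a set \<Rightarrow> nat set \<Rightarrow> bool" where
  "covered N A V J \<longleftrightarrow> (\<forall>x \<in> J \<rightarrow>\<^sub>E V. \<exists>r<N. \<forall>c\<in>J. A r c = x c)"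

definition OCA ::
  "nat \<Rightarrow> nat \<Rightarrow> nat \<Rightarrow> nat \<Rightarrow> nat \<Rightarrow> 'a set \<Rightarrow> (nat \<Rightarrow> nat \<Rightarrow> 'a) \<Rightarrow> bool" where
  "OCA N t m s v V A \<longleftrightarrow>
     finite V \<and> card V = v \<and>
     (\<forall>r<N. \<forall>c\<in>nrt_points m s. A r c \<in> V) \<and>
     (\<forall>J. nrt_anti_ideal m s J \<and> card J = t \<longrightarrow> covered N A V J)"

text \<open>Every finite alphabet can be relabelled by natural numbers, so it suffices to let the
  alphabet range over finite sets of naturals. For \<open>v > 0\<close> the set of admissible \<open>N\<close> is
  nonempty (list all rows over the alphabet), so the minimum is attained.\<close>

definition OCAN :: "nat \<Rightarrow> nat \<Rightarrow> nat \<Rightarrow> nat \<Rightarrow> nat" where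
  "OCAN t m s v =
     (LEAST N. 0 < N \<and> (\<exists>(V :: nat set) (A :: nat \<Rightarrow> nat \<Rightarrow> nat). OCA N t m s v V A))"

end

theory Submission imports Defs
begin

text \<open>
  Give the new block a copy of the last block of an optimal array of strength \<open>t\<close>. For an anti-ideal
  with \<open>a\<close> points in the last old block and \<open>b\<close> points in the new block, this covers all
  tuples whose top \<open>min a b\<close> entries in these two blocks agree. The other tuples are covered as
  follows, with \<open>j = a + b\<close>. Write a word of length \<open>j\<close> into one of the two blocks starting from the
  top, and its reversal into the other: for every splitting \<open>j = a + b\<close> the top \<open>a\<close> and the top \<open>b\<close>
  entries together form exactly this word. A tuple without the agreement yields a word that is not
  a palindrome, so each of the \<open>v\<^sup>j - v\<^bsup>\<lceil>j/2\<rceil>\<^esup>\<close> words that are not palindromes, combined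
  with an array of strength \<open>t - j\<close> on the remaining \<open>m - 1\<close> blocks, suffices.
\<close>

section \<open>Anti-ideals\<close>

text \<open>Taking complements turns downward closure into upward closure. This gives a criterion on
  \<open>J\<close> itself, with no existentially quantified ideal.\<close>

lemma nrt_anti_ideal_iff:
  "nrt_anti_ideal m s J \<longleftrightarrow>
     J \<subseteq> nrt_points m s \<and> (\<forall>a\<in>J. \<forall>b\<in>nrt_points m s. nrt_le m s a b \<longrightarrow> b \<in> J)"
  (is "_ \<longleftrightarrow> ?R")
proof
  assume "nrt_anti_ideal m s J"
  then show ?R
    unfolding nrt_anti_ideal_def nrt_ideal_def by blast
next
  assume R: ?R
  then have "nrt_ideal m s (nrt_points m s - J)"
    unfolding nrt_ideal_def by blast
  moreover have "J = nrt_points m s - (nrt_points m s - J)"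
    using R by blast
  ultimately show "nrt_anti_ideal m s J"
    unfolding nrt_anti_ideal_def by blast
qed

lemma nrt_anti_ideal_finite: "nrt_anti_ideal m s J \<Longrightarrow> finite J"
  unfolding nrt_anti_ideal_iff nrt_points_def using finite_subset by blast

lemma nrt_block_le: "i < n \<Longrightarrow> a \<in> nrt_block s i \<Longrightarrow> a \<le> n * s"
  unfolding nrt_block_def
  by (metis Suc_eq_plus1 Suc_leI atLeastAtMost_iff le_trans mult_le_mono1)

lemma nrt_le_Suc:
  "nrt_le (Suc n) s a b \<longleftrightarrow> nrt_le n s a b \<or> (n * s < a \<and> a \<le> b \<and> b \<le> Suc n * s)"
  unfolding nrt_le_def less_Suc_eq nrt_block_def by auto

lemma nrt_le_bounds: "nrt_le n s a b \<Longrightarrow> a \<le> n * s \<and> b \<le> n * s"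
  unfolding nrt_le_def using nrt_block_le by blast

text \<open>Such a set is the interval from its minimum up to \<open>u\<close>, so its size
  \<open>a\<close> describes it. The half-open form includes the empty set as
  \<open>a = 0\<close>.\<close>

lemma upward_closed_segment:
  fixes l u :: nat
  assumes "T \<subseteq> {l<..u}" and up: "\<And>a b. a \<in> T \<Longrightarrow> a \<le> b \<Longrightarrow> b \<le> u \<Longrightarrow> b \<in> T"
  shows "\<exists>a \<le> u - l. T = {u - a<..u}"
proof (cases "T = {}")
  case True
  then show ?thesis by auto
next
  case False
  have fin: "finite T" using assms(1) finite_subset by blast
  then have mem: "Min T \<in> T" using False by simp
  then have bd: "l < Min T" "Min T \<le> u" using assms(1) by auto
  have "T = {u - (u + 1 - Min T)<..u}"
  proof (intro set_eqI iffI)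
    fix c assume "c \<in> T"
    then have "Min T \<le> c" "c \<le> u" using fin assms(1) by auto
    then show "c \<in> {u - (u + 1 - Min T)<..u}" using bd by auto
  next
    fix c assume "c \<in> {u - (u + 1 - Min T)<..u}"
    then have "Min T \<le> c" "c \<le> u" using bd by auto
    then show "c \<in> T" using up mem by blast
  qed
  moreover have "u + 1 - Min T \<le> u - l" using bd by simp
  ultimately show ?thesis by blast
qed

text \<open>Elements of different blocks are incomparable, so closure can be checked separately on
  the last block and on the others. Applied twice, this peels off the new block and then the last
  old one.\<close>

lemma nrt_anti_ideal_Suc_iff:
  "nrt_anti_ideal (Suc n) s J \<longleftrightarrow>
     (\<exists>K a. nrt_anti_ideal n s K \<and> a \<le> s \<and> J = K \<union> {Suc n * s - a<..Suc n * s})"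
  (is "?L \<longleftrightarrow> ?R")
proof
  assume L: ?L
  then have sub: "J \<subseteq> {1..Suc n * s}"
    and up: "\<And>a b. a \<in> J \<Longrightarrow> b \<in> {1..Suc n * s} \<Longrightarrow> nrt_le (Suc n) s a b \<Longrightarrow> b \<in> J"
    unfolding nrt_anti_ideal_iff nrt_points_def by blast+
  let ?K = "J \<inter> {1..n * s}" and ?T = "J \<inter> {n * s<..Suc n * s}"
  have K: "nrt_anti_ideal n s ?K"
    unfolding nrt_anti_ideal_iff nrt_points_def
    using up by (auto simp: nrt_le_Suc)
  have "\<exists>a \<le> Suc n * s - n * s. ?T = {Suc n * s - a<..Suc n * s}"
  proof (rule upward_closed_segment)
    fix c d assume c: "c \<in> ?T" and d: "c \<le> d" "d \<le> Suc n * s"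
    then have "nrt_le (Suc n) s c d" "d \<in> {1..Suc n * s}" "n * s < d"
      unfolding nrt_le_Suc by auto
    then show "d \<in> ?T" using up[of c d] c d by simp
  qed blast
  then obtain a where a: "a \<le> s" "?T = {Suc n * s - a<..Suc n * s}" by auto
  have "J = ?K \<union> ?T" using sub by auto
  then show ?R using K a by metis
next
  assume ?R
  then obtain K a where K: "nrt_anti_ideal n s K" and a: "a \<le> s"
    and J: "J = K \<union> {Suc n * s - a<..Suc n * s}" by blast
  from K have sub: "K \<subseteq> {1..n * s}"
    and up: "\<And>a b. a \<in> K \<Longrightarrow> b \<in> {1..n * s} \<Longrightarrow> nrt_le n s a b \<Longrightarrow> b \<in> K"
    unfolding nrt_anti_ideal_iff nrt_points_def by blast+
  have le: "n * s \<le> Suc n * s - a" using a by simp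
  show ?L
    unfolding nrt_anti_ideal_iff nrt_points_def
  proof (intro conjI ballI impI)
    show "J \<subseteq> {1..Suc n * s}" using sub J by force
    fix c d assume c: "c \<in> J" and d: "d \<in> {1..Suc n * s}" and cd: "nrt_le (Suc n) s c d"
    from cd consider "nrt_le n s c d" | "n * s < c" "c \<le> d" "d \<le> Suc n * s"
      unfolding nrt_le_Suc by blast
    then show "d \<in> J"
    proof cases
      case 1
      then have "c \<le> n * s" "d \<le> n * s" using nrt_le_bounds by blast+
      then show ?thesis using c d J le up[OF _ _ 1] by auto
    next
      case 2
      then have "c \<notin> K" using sub by force
      then show ?thesis using c 2 J by auto
    qed
  qed
qed

lemma nrt_anti_ideal_extend_one:
  assumes J: "nrt_anti_ideal m s J" and "card J < m * s"
  shows "\<exists>c. c \<notin> J \<and> nrt_anti_ideal m s (insert c J)"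
proof -
  let ?I = "nrt_points m s - J"
  have "?I \<noteq> {}"
  proof
    assume "?I = {}"
    then have "nrt_points m s \<subseteq> J" by blast
    then have "card (nrt_points m s) \<le> card J"
      using card_mono nrt_anti_ideal_finite[OF J] by blast
    then show False using assms(2) by (simp add: nrt_points_def)
  qed
  have fin: "finite ?I" by (simp add: nrt_points_def)
  \<comment> \<open>The order within a block is the order of the labels, so everything strictly
    above the largest missing label already lies in \<open>J\<close>.\<close>
  define c where "c = Max ?I"
  have c: "c \<in> ?I" unfolding c_def using fin \<open>?I \<noteq> {}\<close> by (rule Max_in)
  have "b \<in> insert c J" if "b \<in> nrt_points m s" "nrt_le m s c b" for b
  proof (rule ccontr)
    assume "b \<notin> insert c J"
    then have "b \<le> c" using that(1) fin unfolding c_def by (simp add: Max_ge)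
    moreover have "c \<le> b" using that(2) unfolding nrt_le_def by blast
    ultimately show False using \<open>b \<notin> insert c J\<close> by simp
  qed
  then have "nrt_anti_ideal m s (insert c J)"
    using J c unfolding nrt_anti_ideal_iff by blast
  then show ?thesis using c by blast
qed

text \<open>An array of strength \<open>t\<close> speaks only about anti-ideals of size exactly
  \<open>t\<close>. Enlarging a smaller one lets the array cover it as well.\<close>

lemma nrt_anti_ideal_extend:
  assumes "nrt_anti_ideal m s J" "card J \<le> t" "t \<le> m * s"
  shows "\<exists>J'. J \<subseteq> J' \<and> nrt_anti_ideal m s J' \<and> card J' = t"
  using assms
proof (induction "t - card J" arbitrary: J)
  case 0
  then show ?case by auto
next
  case (Suc d)
  then have "card J < m * s" by linarith
  then obtain c where c: "c \<notin> J" "nrt_anti_ideal m s (insert c J)"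
    using nrt_anti_ideal_extend_one[OF Suc.prems(1)] by blast
  have "card (insert c J) = Suc (card J)"
    using c nrt_anti_ideal_finite[OF Suc.prems(1)] by simp
  then have "d = t - card (insert c J)" "card (insert c J) \<le> t" using Suc.hyps(2) by linarith+
  then show ?case using Suc.hyps(1)[OF _ c(2) _ Suc.prems(3)] by blast
qed

section \<open>Arrays with arbitrary row indices\<close>

text \<open>An enumeration of \<open>R\<close> transfers coverage to rows numbered from 0. Rows can
  then be indexed by functions or by a disjoint sum.\<close>

lemma OCA_of_rows:
  assumes "finite R" "finite V" "card V = v"
    and "\<And>r c. r \<in> R \<Longrightarrow> c \<in> nrt_points m s \<Longrightarrow> B r c \<in> V"
    and cov: "\<And>J x. nrt_anti_ideal m s J \<Longrightarrow> card J = t \<Longrightarrow> x \<in> J \<rightarrow>\<^sub>E V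
      \<Longrightarrow> \<exists>r\<in>R. \<forall>c\<in>J. B r c = x c"
  shows "\<exists>A. OCA (card R) t m s v V A"
proof -
  obtain h where h: "bij_betw h {..<card R} R"
    using ex_bij_betw_nat_finite[OF assms(1)] by (auto simp: atLeast0LessThan)
  have "covered (card R) (\<lambda>r. B (h r)) V J" if "nrt_anti_ideal m s J" "card J = t" for J
    unfolding covered_def
  proof
    fix x assume "x \<in> J \<rightarrow>\<^sub>E V"
    from cov[OF that this] obtain r where r: "r \<in> R" "\<forall>c\<in>J. B r c = x c" by blast
    then obtain r' where "r' < card R" "r = h r'" using h unfolding bij_betw_def by auto
    then show "\<exists>r<card R. \<forall>c\<in>J. B (h r) c = x c" using r by blast
  qed
  moreover have "h r \<in> R" if "r < card R" for r using h that unfolding bij_betw_def by auto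
  ultimately have "OCA (card R) t m s v V (\<lambda>r. B (h r))"
    unfolding OCA_def using assms by blast
  then show ?thesis by blast
qed

lemma OCAN_le_card_rows:
  fixes V :: "nat set"
  assumes "finite R" "R \<noteq> {}" "finite V" "card V = v"
    and "\<And>r c. r \<in> R \<Longrightarrow> c \<in> nrt_points m s \<Longrightarrow> B r c \<in> V"
    and "\<And>J x. nrt_anti_ideal m s J \<Longrightarrow> card J = t \<Longrightarrow> x \<in> J \<rightarrow>\<^sub>E V
      \<Longrightarrow> \<exists>r\<in>R. \<forall>c\<in>J. B r c = x c"
  shows "OCAN t m s v \<le> card R"
  unfolding OCAN_def
proof (rule Least_le, intro conjI)
  show "0 < card R" using assms(1,2) by (simp add: card_gt_0_iff)
  show "\<exists>(V :: nat set) A. OCA (card R) t m s v V A"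
    using OCA_of_rows[OF assms(1,3-6)] by blast
qed

text \<open>Optimal arrays of different strengths may come with different alphabets. A bijection of
  alphabets moves them to a common one, so that their entries can be combined in one row.\<close>

lemma OCA_relabel:
  assumes A: "OCA N t m s v V A" and "finite W" "card W = v"
  shows "\<exists>B. OCA N t m s v W B"
proof -
  have V: "finite V" "card V = v" using A unfolding OCA_def by auto
  then obtain g where g: "bij_betw g V W" using assms finite_same_card_bij by metis
  have "covered N (\<lambda>r c. g (A r c)) W J" if J: "nrt_anti_ideal m s J" "card J = t" for J
    unfolding covered_def
  proof
    fix x assume x: "x \<in> J \<rightarrow>\<^sub>E W"
    define y where "y = restrict (\<lambda>c. inv_into V g (x c)) J"
    have W: "x c \<in> g ` V" if "c \<in> J" for c using that x g unfolding bij_betw_def by auto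
    have "y \<in> J \<rightarrow>\<^sub>E V" unfolding y_def using W by (auto intro: inv_into_into)
    then obtain r where r: "r < N" "\<forall>c\<in>J. A r c = y c"
      using A J unfolding OCA_def covered_def by blast
    have "g (A r c) = x c" if "c \<in> J" for c
      using that r W by (auto simp: y_def f_inv_into_f)
    then show "\<exists>r<N. \<forall>c\<in>J. g (A r c) = x c" using r by blast
  qed
  moreover have "g a \<in> W" if "a \<in> V" for a using g that unfolding bij_betw_def by auto
  ultimately have "OCA N t m s v W (\<lambda>r c. g (A r c))"
    using A assms unfolding OCA_def by auto
  then show ?thesis by blast
qed

text \<open>\<open>LEAST\<close> is informative only once some admissible number is exhibited. The
  array of all rows over \<open>{..<v}\<close> provides one; it has a row because
  \<open>v \<ge> 1\<close>.\<close>

lemma OCAN_attained: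
  assumes "v \<ge> 1"
  shows "0 < OCAN t m s v \<and> (\<exists>A. OCA (OCAN t m s v) t m s v {..<v} A)"
proof -
  let ?R = "nrt_points m s \<rightarrow>\<^sub>E {..<v}"
  let ?P = "\<lambda>N. 0 < N \<and> (\<exists>(V :: nat set) (A :: nat \<Rightarrow> nat \<Rightarrow> nat). OCA N t m s v V A)"
  have fin: "finite ?R" by (intro finite_PiE) (auto simp: nrt_points_def)
  have "0 \<in> {..<v}" using assms by simp
  then have "?R \<noteq> {}" by (auto simp: PiE_eq_empty_iff)
  have "\<exists>A. OCA (card ?R) t m s v {..<v} A"
  proof (rule OCA_of_rows[where B = "\<lambda>r. r"])
    fix J :: "nat set" and x :: "nat \<Rightarrow> nat"
    assume J: "nrt_anti_ideal m s J" and x: "x \<in> J \<rightarrow>\<^sub>E {..<v}"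
    \<comment> \<open>The tuple is padded with the letter 0 outside \<open>J\<close> to give a full
      row.\<close>
    let ?r = "\<lambda>c\<in>nrt_points m s. if c \<in> J then x c else 0"
    have "?r \<in> ?R" using x assms by auto
    moreover have "\<forall>c\<in>J. ?r c = x c" using J unfolding nrt_anti_ideal_iff by auto
    ultimately show "\<exists>r\<in>?R. \<forall>c\<in>J. r c = x c" by blast
  qed (use fin in auto)
  then have "?P (card ?R)" using fin \<open>?R \<noteq> {}\<close> by (auto simp: card_gt_0_iff)
  then have "?P (OCAN t m s v)" unfolding OCAN_def by (rule LeastI)
  then show ?thesis using OCA_relabel by (metis card_lessThan finite_lessThan)
qed

section \<open>Words that are not palindromes\<close>

definition nonpal_words :: "'a set \<Rightarrow> nat \<Rightarrow> 'a list set" where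
  "nonpal_words V j = {xs. set xs \<subseteq> V \<and> length xs = j \<and> rev xs \<noteq> xs}"

text \<open>The first half of a palindrome, including the middle letter when \<open>j\<close> is
  odd, may be chosen freely. Reflecting it is injective, which is enough for a lower bound.\<close>

lemma card_palindromes_ge:
  assumes "finite V"
  shows "card V ^ ((j + 1) div 2) \<le> card {xs. set xs \<subseteq> V \<and> length xs = j \<and> rev xs = xs}"
proof -
  let ?H = "{ys. set ys \<subseteq> V \<and> length ys = (j + 1) div 2}"
  let ?P = "{xs. set xs \<subseteq> V \<and> length xs = j \<and> rev xs = xs}"
  let ?f = "\<lambda>ys. ys @ rev (take (j div 2) ys)"
  have "inj_on ?f ?H" by (auto simp: inj_on_def)
  moreover have "?f ` ?H \<subseteq> ?P"
  proof
    fix xs assume "xs \<in> ?f ` ?H"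
    then obtain ys where ys: "set ys \<subseteq> V" "length ys = (j + 1) div 2" "xs = ?f ys" by blast
    \<comment> \<open>The left side is the reversal of \<open>?f ys\<close>. For odd
      \<open>j\<close>, with \<open>ys = zs @ [z]\<close>, both sides are
      \<open>zs @ [z] @ rev zs\<close>, so the middle letter is not doubled.\<close>
    have "take (j div 2) ys @ rev ys = ys @ rev (take (j div 2) ys)"
    proof (cases "even j")
      case True
      then show ?thesis using ys by simp
    next
      case False
      then have "length ys = Suc (j div 2)" using ys by simp
      then obtain zs z where "ys = zs @ [z]" "length zs = j div 2"
        by (metis length_Suc_conv_rev)
      then show ?thesis by simp
    qed
    moreover have "length xs = j" using ys by (auto simp: min_def)
    ultimately show "xs \<in> ?P" using ys by (auto dest: in_set_takeD)
  qed
  moreover have "finite ?P"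
    by (rule finite_subset[OF _ finite_lists_length_eq[OF assms, of j]]) auto
  ultimately have "card ?H \<le> card ?P" by (rule card_inj_on_le)
  then show ?thesis using card_lists_length_eq[OF assms] by simp
qed

lemma finite_nonpal_words: "finite V \<Longrightarrow> finite (nonpal_words V j)"
  unfolding nonpal_words_def
  by (rule finite_subset[OF _ finite_lists_length_eq[of V j]]) auto

lemma card_nonpal_words_le:
  assumes "finite V"
  shows "int (card (nonpal_words V j)) \<le> int (card V) ^ j - int (card V) ^ nat \<lceil>real j / 2\<rceil>"
proof -
  let ?L = "{xs. set xs \<subseteq> V \<and> length xs = j}"
  let ?P = "{xs. set xs \<subseteq> V \<and> length xs = j \<and> rev xs = xs}"
  have finL: "finite ?L" by (rule finite_lists_length_eq[OF assms])
  then have finP: "finite ?P" by (rule rev_finite_subset) auto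
  have "?L = nonpal_words V j \<union> ?P" "nonpal_words V j \<inter> ?P = {}"
    unfolding nonpal_words_def by auto
  then have "card ?L = card (nonpal_words V j) + card ?P"
    using card_Un_disjoint[OF finite_nonpal_words[OF assms] finP] by simp
  then have "card V ^ j = card (nonpal_words V j) + card ?P"
    using card_lists_length_eq[OF assms] by simp
  then have "card (nonpal_words V j) + card V ^ ((j + 1) div 2) \<le> card V ^ j"
    using card_palindromes_ge[OF assms, of j] by linarith
  moreover have "nat \<lceil>real j / 2\<rceil> = (j + 1) div 2"
  proof -
    have "\<lceil>real j / 2\<rceil> = int ((j + 1) div 2)"
      by (rule ceiling_unique) (cases "even j"; auto elim!: evenE oddE)+
    then show ?thesis by simp
  qed
  ultimately show ?thesis
    by (metis le_diff_eq of_nat_add of_nat_le_iff of_nat_power)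
qed

section \<open>Adding a block\<close>

text \<open>The index is a depth: 0 stands for the largest label of a block. Below the end of the
  word the default 0 fills the block, which is a valid letter when \<open>v \<ge> 1\<close>.\<close>

definition letter :: "nat list \<Rightarrow> nat \<Rightarrow> nat" where
  "letter xs d = (if d < length xs then xs ! d else 0)"

lemma letter_less: "set xs \<subseteq> {..<v} \<Longrightarrow> v \<ge> 1 \<Longrightarrow> letter xs d < v"
  unfolding letter_def using nth_mem by fastforce

text \<open>\<open>Inl\<close> rows come from the array of strength \<open>t\<close>, the shift by
  \<open>s\<close> copying its last block. An \<open>Inr\<close> row joins row \<open>r\<close> of
  the array \<open>C j\<close> to the word \<open>xs\<close> in the last old block and its reversal
  in the new one.\<close>

definition new_row ::
  "nat \<Rightarrow> nat \<Rightarrow> (nat \<Rightarrow> nat \<Rightarrow> nat) \<Rightarrow> (nat \<Rightarrow> nat \<Rightarrow> nat \<Rightarrow> nat)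
    \<Rightarrow> nat + nat \<times> nat \<times> nat list \<Rightarrow> nat \<Rightarrow> nat" where
  "new_row n s A C q c = (case q of
     Inl r \<Rightarrow> if c \<le> Suc n * s then A r c else A r (c - s)
   | Inr (j, r, xs) \<Rightarrow>
       if c \<le> n * s then C j r c
       else if c \<le> Suc n * s then letter xs (Suc n * s - c)
       else letter (rev xs) (Suc (Suc n) * s - c))"

text \<open>A column of the new block reads the entry of \<open>A\<close> that lies \<open>s\<close>
  places to the left. The demands on both blocks therefore fall on the top \<open>max a b\<close>
  columns of the last old block; they overlap in the top \<open>min a b\<close> columns, where
  \<open>agree\<close> makes them consistent.\<close>

lemma new_row_old_copy:
  assumes A: "OCA N t (Suc n) s v {..<v} A" and "t \<le> Suc n * s" and "v \<ge> 1"
    and K: "nrt_anti_ideal n s K" and "a \<le> s" "b \<le> s"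
    and J: "J = K \<union> {Suc n * s - a<..Suc n * s} \<union> {Suc (Suc n) * s - b<..Suc (Suc n) * s}"
    and t: "card K + max a b \<le> t" and x: "x \<in> J \<rightarrow>\<^sub>E {..<v}"
    and agree: "\<And>d. d < min a b \<Longrightarrow> x (Suc n * s - d) = x (Suc (Suc n) * s - d)"
  shows "\<exists>r<N. \<forall>c\<in>J. new_row n s A C (Inl r) c = x c"
proof -
  define u where "u = Suc n * s"
  have u: "s \<le> u" "Suc n * s = u" "Suc (Suc n) * s = u + s" "n * s = u - s"
    unfolding u_def by auto
  have Ksub: "K \<subseteq> {1..u - s}"
    using K unfolding nrt_anti_ideal_iff nrt_points_def u by blast
  let ?T = "K \<union> {u - max a b<..u}"
  have T: "nrt_anti_ideal (Suc n) s ?T"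
    unfolding nrt_anti_ideal_Suc_iff u using K \<open>a \<le> s\<close> \<open>b \<le> s\<close> by (metis max.bounded_iff)
  have "card ?T \<le> card K + card {u - max a b<..u}" by (rule card_Un_le)
  then have "card ?T \<le> t" using t by simp
  then obtain T' where T': "?T \<subseteq> T'" "nrt_anti_ideal (Suc n) s T'" "card T' = t"
    using nrt_anti_ideal_extend[OF T] \<open>t \<le> Suc n * s\<close> by blast
  \<comment> \<open>The demands are merged into one tuple on \<open>T'\<close>: entries of
    \<open>x\<close> first, then those of the new block shifted back, and 0 on the columns added by
    the extension.\<close>
  define y where "y = (\<lambda>c\<in>T'. if c \<in> K \<union> {u - a<..u} then x c
    else if c \<in> {u - b<..u} then x (c + s) else 0)"
  have "x c < v" if "c \<in> J" for c using that x by auto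
  moreover have "c + s \<in> J" if "c \<in> {u - b<..u}" for c
    using that \<open>b \<le> s\<close> u unfolding J by auto
  ultimately have "y \<in> T' \<rightarrow>\<^sub>E {..<v}"
    using \<open>v \<ge> 1\<close> unfolding y_def J u by auto
  then obtain r where r: "r < N" "\<And>c. c \<in> T' \<Longrightarrow> A r c = y c"
    using A T' unfolding OCA_def covered_def by blast
  have "new_row n s A C (Inl r) c = x c" if c: "c \<in> J" for c
  proof -
    consider "c \<in> K \<union> {u - a<..u}" | "c \<in> {u + s - b<..u + s}"
      using c unfolding J u by blast
    then show ?thesis
    proof cases
      case 1
      then have "c \<in> T'" "c \<le> u" using T'(1) Ksub by fastforce+
      then show ?thesis using 1 r(2) by (simp add: new_row_def u y_def)
    next
      case 2
      define e where "e = c - s"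
      have e: "c = e + s" "e \<in> {u - b<..u}" "\<not> e + s \<le> u" "u - s < e"
        using 2 \<open>b \<le> s\<close> u(1) unfolding e_def by auto
      have mem: "e \<in> T'" using T'(1) e(2) by auto
      have "e \<notin> K" using Ksub e(4) by auto
      have "y e = x (e + s)"
      proof (cases "e \<in> {u - a<..u}")
        case True
        \<comment> \<open>At depth \<open>u - e\<close> both blocks prescribe an entry, so
          \<open>agree\<close> applies there.\<close>
        have "u - e < min a b" "u - (u - e) = e" "u + s - (u - e) = e + s"
          using True e(2) by auto
        then have "x e = x (e + s)" using agree[of "u - e"] unfolding u by simp
        then show ?thesis using True mem by (simp add: y_def)
      next
        case False
        then show ?thesis using mem e \<open>e \<notin> K\<close> by (simp add: y_def)
      qed
      then show ?thesis using e mem r(2) unfolding new_row_def u by simp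
    qed
  qed
  then show ?thesis using r(1) by blast
qed

text \<open>The strength of \<open>C (a + b)\<close> is exactly \<open>card K\<close>, so one of its
  rows realises \<open>x\<close> on \<open>K\<close>, and a single word supplies all remaining
  entries. The disagreement at depth \<open>d0\<close> keeps this word from being a
  palindrome.\<close>

lemma new_row_word:
  assumes C: "OCA N (card K) n s v {..<v} (C (a + b))"
    and K: "nrt_anti_ideal n s K" and "a \<le> s" "b \<le> s"
    and J: "J = K \<union> {Suc n * s - a<..Suc n * s} \<union> {Suc (Suc n) * s - b<..Suc (Suc n) * s}"
    and x: "x \<in> J \<rightarrow>\<^sub>E {..<v}"
    and d0: "d0 < min a b" "x (Suc n * s - d0) \<noteq> x (Suc (Suc n) * s - d0)"
  shows "\<exists>r<N. \<exists>xs\<in>nonpal_words {..<v} (a + b).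
    \<forall>c\<in>J. new_row n s A C (Inr (a + b, r, xs)) c = x c"
proof -
  define u where "u = Suc n * s"
  have u: "s \<le> u" "Suc n * s = u" "Suc (Suc n) * s = u + s" "n * s = u - s"
    unfolding u_def by auto
  have Ksub: "K \<subseteq> {1..u - s}"
    using K unfolding nrt_anti_ideal_iff nrt_points_def u by blast
  \<comment> \<open>The entries of the last old block are read downwards from the top, then those of
    the new block upwards. Thus \<open>xs\<close> begins with the former and \<open>rev xs\<close>
    with the latter, both in order of depth.\<close>
  define xs where "xs = map (\<lambda>d. x (u - d)) [0..<a] @ rev (map (\<lambda>d. x (u + s - d)) [0..<b])"
  have len: "length xs = a + b" unfolding xs_def by simp
  have fwd: "letter xs d = x (u - d)" if "d < a" for d
    using that unfolding letter_def xs_def by (simp add: nth_append)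
  have bwd: "letter (rev xs) d = x (u + s - d)" if "d < b" for d
    using that unfolding letter_def xs_def by (simp add: nth_append)
  \<comment> \<open>Since \<open>d0\<close> is below both \<open>a\<close> and \<open>b\<close>,
    position \<open>d0\<close> of \<open>xs\<close> and of \<open>rev xs\<close> holds the two
    differing entries.\<close>
  have "rev xs \<noteq> xs" using fwd[of d0] bwd[of d0] d0 unfolding u by auto
  moreover have "set xs \<subseteq> {..<v}"
  proof -
    have "x (u - d) < v" if "d < a" for d
    proof -
      have "u - d \<in> J" using that \<open>a \<le> s\<close> u unfolding J by auto
      then show ?thesis using x by auto
    qed
    moreover have "x (u + s - d) < v" if "d < b" for d
    proof -
      have "u + s - d \<in> J" using that \<open>b \<le> s\<close> u unfolding J by auto
      then show ?thesis using x by auto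
    qed
    ultimately show ?thesis unfolding xs_def by auto
  qed
  ultimately have xs: "xs \<in> nonpal_words {..<v} (a + b)"
    unfolding nonpal_words_def using len by simp
  have "restrict x K \<in> K \<rightarrow>\<^sub>E {..<v}" using x J by auto
  then obtain r where r: "r < N" "\<And>c. c \<in> K \<Longrightarrow> C (a + b) r c = x c"
    using C K unfolding OCA_def covered_def by (metis restrict_apply')
  have "new_row n s A C (Inr (a + b, r, xs)) c = x c" if c: "c \<in> J" for c
  proof -
    consider "c \<in> K" | "c \<in> {u - a<..u}" | "c \<in> {u + s - b<..u + s}"
      using c unfolding J u by blast
    then show ?thesis
    proof cases
      case 1
      then have "c \<le> u - s" using Ksub by auto
      then show ?thesis using 1 r(2) by (simp add: new_row_def u)
    next
      case 2
      then have "\<not> c \<le> u - s" "c \<le> u" "u - c < a" "u - (u - c) = c"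
        using \<open>a \<le> s\<close> u by auto
      then show ?thesis using fwd[of "u - c"] by (simp add: new_row_def u)
    next
      case 3
      then have "\<not> c \<le> u - s" "\<not> c \<le> u" "u + s - c < b" "u + s - (u + s - c) = c"
        using \<open>b \<le> s\<close> u by auto
      then show ?thesis using bwd[of "u + s - c"] unfolding new_row_def u by simp
    qed
  qed
  then show ?thesis using r(1) xs by blast
qed

theorem theorem8:
  fixes t m s v k :: nat
  assumes "t \<ge> 2" and "m \<ge> 2" and "s \<ge> 1" and "v \<ge> 1"
    and "s \<le> t" and "t \<le> m * s"
    and "k = min (2 * s) t"
  shows "int (OCAN t (m + 1) s v)
    \<le> int (OCAN t m s v)
      + (\<Sum>j = 2..k. int (OCAN (t - j) (m - 1) s v)
                      * (int v ^ j - int v ^ nat \<lceil>real j / 2\<rceil>))"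
proof -
  define n where "n = m - 1"
  have m: "m = Suc n" using \<open>m \<ge> 2\<close> n_def by simp
  define N where "N = OCAN t (Suc n) s v"
  define M where "M j = OCAN (t - j) n s v" for j
  let ?V = "{..<v}"
  obtain A where A: "OCA N t (Suc n) s v ?V A" and "0 < N"
    unfolding N_def using OCAN_attained[OF \<open>v \<ge> 1\<close>] by blast
  \<comment> \<open>Truncated subtraction gives strength 0 for \<open>j > t\<close>, so the arrays
    can be chosen uniformly for all \<open>j\<close>.\<close>
  have "\<exists>C. \<forall>j. OCA (M j) (t - j) n s v ?V (C j)"
    unfolding M_def by (intro choice allI) (use OCAN_attained[OF \<open>v \<ge> 1\<close>] in blast)
  then obtain C where C: "\<And>j. OCA (M j) (t - j) n s v ?V (C j)" by blast
  \<comment> \<open>Each word of length \<open>j\<close> is paired with every row of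
    \<open>C j\<close>, which yields the products in the bound.\<close>
  define R where "R = {..<N} <+> (SIGMA j:{2..k}. {..<M j} \<times> nonpal_words ?V j)"
  have finR: "finite R" unfolding R_def by (auto intro!: finite_nonpal_words)
  have "OCAN t (Suc (Suc n)) s v \<le> card R"
  proof (rule OCAN_le_card_rows[where B = "new_row n s A C" and V = ?V])
    show "R \<noteq> {}" using \<open>0 < N\<close> unfolding R_def by auto
    fix q c assume q: "q \<in> R" and c: "c \<in> nrt_points (Suc (Suc n)) s"
    have Aval: "\<And>r c. r < N \<Longrightarrow> 1 \<le> c \<Longrightarrow> c \<le> Suc n * s \<Longrightarrow> A r c < v"
      using A unfolding OCA_def nrt_points_def by simp
    have Cval: "\<And>j r c. r < M j \<Longrightarrow> 1 \<le> c \<Longrightarrow> c \<le> n * s \<Longrightarrow> C j r c < v"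
      using C unfolding OCA_def nrt_points_def by simp
    have cb: "1 \<le> c" "c \<le> Suc n * s + s" using c unfolding nrt_points_def by auto
    show "new_row n s A C q c \<in> ?V"
    proof (cases q)
      case (Inl r)
      then have "r < N" using q unfolding R_def by auto
      moreover have "1 \<le> c - s" "c - s \<le> Suc n * s" if "\<not> c \<le> Suc n * s"
        using that cb by auto
      ultimately show ?thesis using Inl Aval cb by (simp add: new_row_def)
    next
      case (Inr p)
      obtain j r xs where p: "p = (j, r, xs)" by (cases p)
      then have "r < M j" "set xs \<subseteq> ?V" "set (rev xs) \<subseteq> ?V"
        using q Inr unfolding R_def nonpal_words_def by auto
      then show ?thesis
        using Inr p Cval cb letter_less[OF _ \<open>v \<ge> 1\<close>] by (simp add: new_row_def)
    qed
  next
    fix J x assume J: "nrt_anti_ideal (Suc (Suc n)) s J" "card J = t" and x: "x \<in> J \<rightarrow>\<^sub>E ?V"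
    obtain K a b where K: "nrt_anti_ideal n s K" and ab: "a \<le> s" "b \<le> s"
      and Jeq: "J = K \<union> {Suc n * s - a<..Suc n * s} \<union> {Suc (Suc n) * s - b<..Suc (Suc n) * s}"
      using J(1) nrt_anti_ideal_Suc_iff by metis
    have Ksub: "K \<subseteq> {1..n * s}" using K unfolding nrt_anti_ideal_iff nrt_points_def by blast
    have "card J = card (K \<union> {Suc n * s - a<..Suc n * s}) + b"
      unfolding Jeq
      by (subst card_Un_disjoint) (use Ksub ab nrt_anti_ideal_finite[OF K] in auto)
    also have "card (K \<union> {Suc n * s - a<..Suc n * s}) = card K + a"
      by (subst card_Un_disjoint) (use Ksub ab nrt_anti_ideal_finite[OF K] in auto)
    finally have t: "t = card K + a + b" using J(2) by simp
    show "\<exists>q\<in>R. \<forall>c\<in>J. new_row n s A C q c = x c"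
    proof (cases "\<forall>d < min a b. x (Suc n * s - d) = x (Suc (Suc n) * s - d)")
      case True
      have "\<exists>r<N. \<forall>c\<in>J. new_row n s A C (Inl r) c = x c"
        by (rule new_row_old_copy[OF A _ \<open>v \<ge> 1\<close> K ab Jeq _ x]) (use True t \<open>t \<le> m * s\<close> m in auto)
      then show ?thesis unfolding R_def by blast
    next
      case False
      then obtain d where d: "d < min a b" "x (Suc n * s - d) \<noteq> x (Suc (Suc n) * s - d)"
        by blast
      have "t - (a + b) = card K" using t by simp
      then have "OCA (M (a + b)) (card K) n s v ?V (C (a + b))" using C by metis
      then have "\<exists>r<M (a + b). \<exists>xs\<in>nonpal_words ?V (a + b).
          \<forall>c\<in>J. new_row n s A C (Inr (a + b, r, xs)) c = x c"
        using K ab Jeq x d by (rule new_row_word)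
      then obtain r xs
        where "r < M (a + b)" "xs \<in> nonpal_words ?V (a + b)"
          "\<forall>c\<in>J. new_row n s A C (Inr (a + b, r, xs)) c = x c" by blast
      \<comment> \<open>A disagreement at some \<open>d < min a b\<close> forces \<open>a\<close>
        and \<open>b\<close> to be positive. The upper bound combines \<open>a, b \<le> s\<close>
        with \<open>a + b \<le> t\<close>.\<close>
      moreover have "a + b \<in> {2..k}" using d ab t \<open>k = min (2 * s) t\<close> by auto
      ultimately show ?thesis unfolding R_def by blast
    qed
  qed (use finR in auto)
  moreover have "card R = N + (\<Sum>j = 2..k. M j * card (nonpal_words ?V j))"
    unfolding R_def using finite_nonpal_words[of ?V]
    by (subst card_Plus) (auto simp: card_SigmaI card_cartesian_product)
  ultimately have "int (OCAN t (Suc (Suc n)) s v)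
      \<le> int (N + (\<Sum>j = 2..k. M j * card (nonpal_words ?V j)))"
    by (simp only: of_nat_le_iff)
  also have "\<dots> = int N + (\<Sum>j = 2..k. int (M j) * int (card (nonpal_words ?V j)))"
    by simp
  also have "\<dots> \<le> int N + (\<Sum>j = 2..k. int (M j) * (int v ^ j - int v ^ nat \<lceil>real j / 2\<rceil>))"
    using card_nonpal_words_le[of ?V]
    by (intro add_left_mono sum_mono mult_left_mono) auto
  finally show ?thesis unfolding N_def M_def using m by simp
qed

end
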